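(* Let $M\ge2$, $n\ge1$ be two integers and let a real number $x\ge0$ satisfy $$\frac{\log(M)+x}{n}<3.$$ Let $L>0$ and let $d\ge1$ be an integer. Let $\mathcal{F}$ be the class of probability densities $f$ with respect to the Lebesgue measure on $\mathbf{R}^d$ such that $\|f\|_\infty\le L$. Then there exist $M$ functions $f_1,\ldots,f_M$ in $L^2(\mathbf{R}^d)$ with $\|f_j\|_\infty\le L$ satisfying $$\inf_{\hat T_n}\ \sup_{f\in\mathcal{F}}\ \mathbb{P}_f\left(\|\hat T_n-f\|^2-\min_{j=1,\ldots,M}\|f_j-f\|^2>\frac{L}{24}\left(\frac{\log(M)+x}{n}\right)\right)\ge\frac1{24}\exp(-x),$$ where the infimum is taken over all estimators $\hat T_n$ and $\mathbb{P}_f$ denotes the probability with respect to $n$ i.i.d. observations with density $f$.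
   Context: $\|\cdot\|$ is the $L^2$ norm with respect to the Lebesgue measure on $\mathbf{R}^d$. An estimator $\hat T_n$ is any measurable function of the observations $X_1,\ldots,X_n$ with values in $L^2(\mathbf{R}^d)$. *)

theory Defs
  imports "HOL-Probability.Probability" "HOL-Probability.Essential_Supremum"
begin

definition L2 :: "('a::euclidean_space \<Rightarrow> real) set" where
  "L2 = {f \<in> borel_measurable lborel. integrable lborel (\<lambda>y. (f y)\<^sup>2)}"

definition L2_norm :: "('a::euclidean_space \<Rightarrow> real) \<Rightarrow> real" where
  "L2_norm f = sqrt (\<integral>y. (f y)\<^sup>2 \<partial>lborel)"

definition Linf_norm :: "('a::euclidean_space \<Rightarrow> real) \<Rightarrow> ereal" where
  "Linf_norm f = esssup lborel (\<lambda>y. ereal \<bar>f y\<bar>)"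

text \<open>Elements of \<^term>\<open>L2\<close> are functions, not classes modulo almost-everywhere equality.
  The sets below that are open for the seminorm \<^term>\<open>L2_norm\<close> are saturated for that
  equivalence, so this \<open>\<sigma>\<close>-algebra is the preimage of the Borel \<open>\<sigma>\<close>-algebra of the
  quotient Hilbert space, and measurability into it is measurability into the quotient.\<close>

definition L2_borel :: "('a::euclidean_space \<Rightarrow> real) measure" where
  "L2_borel = sigma L2
     {U. U \<subseteq> L2 \<and> (\<forall>f\<in>U. \<exists>e>0. \<forall>g\<in>L2. L2_norm (\<lambda>y. g y - f y) < e \<longrightarrow> g \<in> U)}"

definition estimators :: "nat \<Rightarrow> ((nat \<Rightarrow> 'a) \<Rightarrow> 'a::euclidean_space \<Rightarrow> real) set" where
  "estimators n = (\<Pi>\<^sub>M i\<in>{1..n}. borel) \<rightarrow>\<^sub>M L2_borel"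

definition bounded_densities :: "real \<Rightarrow> ('a::euclidean_space \<Rightarrow> real) set" where
  "bounded_densities L = {f \<in> borel_measurable lborel.
     (\<forall>y. 0 \<le> f y) \<and> (\<integral>\<^sup>+ y. ennreal (f y) \<partial>lborel) = 1 \<and> Linf_norm f \<le> ereal L}"

definition iid_law :: "nat \<Rightarrow> ('a::euclidean_space \<Rightarrow> real) \<Rightarrow> (nat \<Rightarrow> 'a) measure" where
  "iid_law n f = (\<Pi>\<^sub>M i\<in>{1..n}. density lborel (\<lambda>y. ennreal (f y)))"

end

theory Submission
  imports Defs
begin

text \<open>The hard densities are \<open>f \<omega> = L 1\<^sub>A\<close>, where \<open>\<omega> \<subseteq> {..<K}\<close> and
  \<open>A = C \<union> (\<Union>k<K. S k (k \<in> \<omega>))\<close> for disjoint sets, \<open>C\<close> of volume \<open>(1 - s) / L\<close> and each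
  \<open>S k b\<close> of volume \<open>s / (L K)\<close>. They also serve as dictionary (\<open>2 ^ K \<le> M\<close>), so the minimum in
  the excess risk vanishes. Let \<open>J\<close> be the set of those \<open>k\<close> for which no observation falls into
  \<open>Q k = S k True \<union> S k False\<close>. Flipping \<open>\<omega>\<close> on \<open>J\<close> leaves the likelihood unchanged, whereas the
  squared distance of the two densities is \<open>2 s L |J| / K\<close>, so the squared error for one of them
  is at least \<open>s L |J| / (2 K)\<close>. Averaging over \<open>\<omega>\<close>, the maximal error probability is at least
  half the smallest probability that \<open>J\<close> is large.\<close>

section \<open>Square-integrable functions and the \<sigma>-algebra on \<open>L2\<close>\<close>

text \<open>Since \<open>0 \<le> f \<le> L\<close> almost everywhere, the square is dominated by the
  integrable function \<open>L * f\<close>.\<close>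

lemma bounded_densities_subset_L2: "bounded_densities L \<subseteq> L2"
proof
  fix f :: "'a \<Rightarrow> real" assume f: "f \<in> bounded_densities L"
  then have [measurable]: "f \<in> borel_measurable lborel" and nn: "\<And>y. 0 \<le> f y"
    and one: "(\<integral>\<^sup>+ y. ennreal (f y) \<partial>lborel) = 1" and L: "Linf_norm f \<le> ereal L"
    by (auto simp: bounded_densities_def)
  have int: "integrable lborel f"
    by (rule integrableI_nonneg) (use nn one in auto)
  have "AE y in lborel. ereal \<bar>f y\<bar> \<le> Linf_norm f"
    unfolding Linf_norm_def by (rule esssup_AE)
  then have "AE y in lborel. f y \<le> L"
    by eventually_elim (use L in \<open>force dest: order_trans\<close>)
  then have "AE y in lborel. norm ((f y)\<^sup>2) \<le> norm (L * f y)"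
    by eventually_elim (use nn in \<open>auto simp: power2_eq_square abs_mult intro!: mult_right_mono\<close>)
  then have "integrable lborel (\<lambda>y. (f y)\<^sup>2)"
    by (rule Bochner_Integration.integrable_bound[rotated 2]) (use int in auto)
  then show "f \<in> L2" by (simp add: L2_def)
qed

lemma L2_diff:
  assumes "f \<in> L2" "g \<in> L2" shows "(\<lambda>y. f y - g y) \<in> L2"
proof -
  have [measurable]: "f \<in> borel_measurable lborel" "g \<in> borel_measurable lborel"
    and int: "integrable lborel (\<lambda>y. 2 * (f y)\<^sup>2 + 2 * (g y)\<^sup>2)"
    using assms by (auto simp: L2_def)
  have le: "(a - b)\<^sup>2 \<le> 2 * a\<^sup>2 + 2 * b\<^sup>2" for a b :: real
    using zero_le_power2[of "a + b"] by (simp add: power2_eq_square algebra_simps)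
  have "integrable lborel (\<lambda>y. (f y - g y)\<^sup>2)"
    by (rule Bochner_Integration.integrable_bound[OF int]) (use le in auto)
  then show ?thesis by (simp add: L2_def)
qed

lemma L2_norm_sq: "(L2_norm f)\<^sup>2 = (\<integral>y. (f y)\<^sup>2 \<partial>lborel)"
  by (simp add: L2_norm_def integral_nonneg_AE)

text \<open>The weighted Young inequality
  \<open>2 * a * b \<le> t * a\<^sup>2 + b\<^sup>2 / t\<close>, integrated. It serves as triangle
  inequality: small \<open>t\<close> for openness of the outside of a ball, \<open>t = 1\<close> for
  the separation of two hypotheses.\<close>

lemma L2_norm_sq_diff_le:
  assumes "f \<in> L2" "g \<in> L2" "h \<in> L2" "0 < t"
  shows "(L2_norm (\<lambda>y. f y - h y))\<^sup>2
    \<le> (1 + t) * (L2_norm (\<lambda>y. f y - g y))\<^sup>2 + (1 + 1 / t) * (L2_norm (\<lambda>y. g y - h y))\<^sup>2"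
proof -
  have le: "(a + b)\<^sup>2 \<le> (1 + t) * a\<^sup>2 + (1 + 1 / t) * b\<^sup>2" for a b :: real
  proof -
    have "0 \<le> (t * a - b)\<^sup>2 / t" using assms by simp
    also have "\<dots> = t * a\<^sup>2 + b\<^sup>2 / t - 2 * a * b"
      using assms by (simp add: power2_eq_square field_simps)
    finally show ?thesis by (simp add: power2_eq_square algebra_simps)
  qed
  have *: "integrable lborel (\<lambda>y. (f y - h y)\<^sup>2)" "integrable lborel (\<lambda>y. (f y - g y)\<^sup>2)"
    "integrable lborel (\<lambda>y. (g y - h y)\<^sup>2)"
    using L2_diff[of f h] L2_diff[of f g] L2_diff[of g h] assms by (auto simp: L2_def)
  have "(\<integral>y. (f y - h y)\<^sup>2 \<partial>lborel)
    \<le> (\<integral>y. (1 + t) * (f y - g y)\<^sup>2 + (1 + 1 / t) * (g y - h y)\<^sup>2 \<partial>lborel)"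
  proof (rule integral_mono)
    show "(f y - h y)\<^sup>2 \<le> (1 + t) * (f y - g y)\<^sup>2 + (1 + 1 / t) * (g y - h y)\<^sup>2" for y
      using le[of "f y - g y" "g y - h y"] by simp
  qed (use * in auto)
  also have "\<dots> = (1 + t) * (\<integral>y. (f y - g y)\<^sup>2 \<partial>lborel) + (1 + 1 / t) * (\<integral>y. (g y - h y)\<^sup>2 \<partial>lborel)"
    using * by simp
  finally show ?thesis by (simp add: L2_norm_sq)
qed

lemma space_L2_borel: "space L2_borel = L2"
  unfolding L2_borel_def by (rule space_measure_of) auto

lemma L2_norm_commute: "L2_norm (\<lambda>y. f y - g y) = L2_norm (\<lambda>y. g y - f y)"
  by (simp add: L2_norm_def power2_commute)

text \<open>The set is open because a small \<^term>\<open>t\<close> makes the first factor of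
  \<open>L2_norm_sq_diff_le\<close> close to 1.\<close>

lemma L2_borel_outside_ball:
  assumes f: "f \<in> L2" and c: "0 \<le> c"
  shows "{h \<in> L2. c < (L2_norm (\<lambda>y. h y - f y))\<^sup>2} \<in> sets L2_borel"
  unfolding L2_borel_def
proof (rule in_measure_of; safe)
  fix h assume h: "h \<in> L2" and gt: "c < (L2_norm (\<lambda>y. h y - f y))\<^sup>2" (is "_ < ?d")
  \<comment> \<open>This choice gives \<open>t * c \<le> (?d - c) / 2\<close>, so
    \<open>(1 + t) * c\<close> is at most the midpoint of \<open>c\<close> and \<open>?d\<close>.
    The summand 1 in the denominator covers \<open>c = 0\<close>.\<close>
  define t where "t = (?d - c) / (2 * (c + 1))"
  have t: "0 < t" using gt c by (simp add: t_def)
  have "t * c = (?d - c) / 2 * (c / (c + 1))" using c by (simp add: t_def field_simps)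
  also have "\<dots> \<le> (?d - c) / 2 * 1"
    using gt c by (intro mult_left_mono) auto
  finally have tc: "(1 + t) * c < ?d" using gt by (simp add: algebra_simps)
  \<comment> \<open>The radius solves \<open>(1 + t) * c + (1 + 1 / t) * e\<^sup>2 = ?d\<close>, so
    moving \<open>h\<close> by less than \<open>e\<close> cannot bring the squared distance to
    \<open>f\<close> down to \<open>c\<close>.\<close>
  define e where "e = sqrt ((?d - (1 + t) * c) / (1 + 1 / t))"
  have t': "0 < 1 + 1 / t" using t by (simp add: add_pos_pos)
  have e: "0 < e" using tc t' by (simp add: e_def)
  have "c < (L2_norm (\<lambda>y. g y - f y))\<^sup>2" if g: "g \<in> L2" "L2_norm (\<lambda>y. g y - h y) < e" for g
  proof -
    have "(L2_norm (\<lambda>y. h y - g y))\<^sup>2 < e\<^sup>2"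
      using g by (subst L2_norm_commute) (intro power_strict_mono, auto simp: L2_norm_def)
    also have "e\<^sup>2 = (?d - (1 + t) * c) / (1 + 1 / t)"
      using tc t' by (simp add: e_def)
    finally have "(1 + 1 / t) * (L2_norm (\<lambda>y. h y - g y))\<^sup>2 < ?d - (1 + t) * c"
      using t' by (simp add: less_divide_eq mult.commute)
    moreover have "?d \<le> (1 + t) * (L2_norm (\<lambda>y. g y - f y))\<^sup>2 + (1 + 1 / t) * (L2_norm (\<lambda>y. h y - g y))\<^sup>2"
    proof -
      have "0 < 1 / t" using t by simp
      from L2_norm_sq_diff_le[OF h g(1) f this] show ?thesis by (simp add: add.commute)
    qed
    ultimately have "(1 + t) * c < (1 + t) * (L2_norm (\<lambda>y. g y - f y))\<^sup>2" by linarith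
    then show ?thesis using t by simp
  qed
  with e show "\<exists>e>0. \<forall>g\<in>L2. L2_norm (\<lambda>y. g y - h y) < e \<longrightarrow>
      g \<in> {h \<in> L2. c < (L2_norm (\<lambda>y. h y - f y))\<^sup>2}"
    by auto
qed auto

section \<open>The law of the sample\<close>

lemma density_prob_space:
  assumes "f \<in> bounded_densities L"
  shows "prob_space (density lborel (\<lambda>y. ennreal (f y)))"
proof -
  have [measurable]: "f \<in> borel_measurable lborel" and "(\<integral>\<^sup>+ y. ennreal (f y) \<partial>lborel) = 1"
    using assms by (auto simp: bounded_densities_def)
  then show ?thesis
    by (intro prob_spaceI) (simp add: emeasure_density)
qed

lemma sets_iid_law [measurable_cong]: "sets (iid_law n f) = sets (\<Pi>\<^sub>M i\<in>{1..n}. borel)"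
  unfolding iid_law_def by (intro sets_PiM_cong) auto

lemma iid_law_prob_space: "f \<in> bounded_densities L \<Longrightarrow> prob_space (iid_law n f)"
  unfolding iid_law_def by (intro prob_space_PiM density_prob_space)

lemma emeasure_iid_law_PiE:
  assumes "f \<in> bounded_densities L" and "\<And>i. i \<in> {1..n} \<Longrightarrow> A i \<in> sets borel"
  shows "emeasure (iid_law n f) (Pi\<^sub>E {1..n} A)
    = (\<Prod>i=1..n. emeasure (density lborel (\<lambda>y. ennreal (f y))) (A i))"
proof -
  interpret prob_space "density lborel (\<lambda>y. ennreal (f y))"
    by (rule density_prob_space) fact
  interpret product_sigma_finite "\<lambda>_. density lborel (\<lambda>y. ennreal (f y))"
    by standard
  show ?thesis
    unfolding iid_law_def by (rule emeasure_PiM) (use assms in auto)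
qed

text \<open>This puts all laws under one dominating measure, so that likelihoods can be compared
  sample by sample. Both sides agree on boxes, where the integral factorizes.\<close>

lemma iid_law_eq_density:
  assumes f: "f \<in> bounded_densities L"
  shows "iid_law n f = density (\<Pi>\<^sub>M i\<in>{1..n}. lborel) (\<lambda>X. \<Prod>i=1..n. ennreal (f (X i)))"
proof -
  have [measurable]: "f \<in> borel_measurable lborel"
    using f by (auto simp: bounded_densities_def)
  interpret prob_space "density lborel (\<lambda>y. ennreal (f y))"
    by (rule density_prob_space) fact
  interpret P: product_sigma_finite "\<lambda>_. density lborel (\<lambda>y. ennreal (f y))"
    by standard
  interpret Q: product_sigma_finite "\<lambda>_. lborel :: 'a measure"
    by standard
  show ?thesis unfolding iid_law_def
  proof (rule P.PiM_eqI[symmetric])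
    fix A :: "nat \<Rightarrow> 'a set"
    assume A: "\<And>i. i \<in> {1..n} \<Longrightarrow> A i \<in> sets (density lborel (\<lambda>y. ennreal (f y)))"
    then have [measurable]: "\<And>i. i \<in> {1..n} \<Longrightarrow> A i \<in> sets lborel" by simp
    have "emeasure (density (\<Pi>\<^sub>M i\<in>{1..n}. lborel) (\<lambda>X. \<Prod>i=1..n. ennreal (f (X i)))) (Pi\<^sub>E {1..n} A)
      = (\<integral>\<^sup>+X. (\<Prod>i=1..n. ennreal (f (X i))) * indicator (Pi\<^sub>E {1..n} A) X \<partial>(\<Pi>\<^sub>M i\<in>{1..n}. lborel))"
      by (rule emeasure_density) (auto intro!: sets_PiM_I_finite)
    also have "\<dots> = (\<integral>\<^sup>+X. (\<Prod>i=1..n. ennreal (f (X i)) * indicator (A i) (X i)) \<partial>(\<Pi>\<^sub>M i\<in>{1..n}. lborel))"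
      by (intro nn_integral_cong)
        (auto simp: prod.distrib indicator_def space_PiM PiE_iff prod_zero_iff split: if_splits)
    also have "\<dots> = (\<Prod>i=1..n. \<integral>\<^sup>+y. ennreal (f y) * indicator (A i) y \<partial>lborel)"
      by (rule Q.product_nn_integral_prod) auto
    also have "\<dots> = (\<Prod>i=1..n. emeasure (density lborel (\<lambda>y. ennreal (f y))) (A i))"
      by (intro prod.cong refl emeasure_density[symmetric]) (use A in auto)
    finally show "emeasure (density (\<Pi>\<^sub>M i\<in>{1..n}. lborel) (\<lambda>X. \<Prod>i=1..n. ennreal (f (X i)))) (Pi\<^sub>E {1..n} A)
      = (\<Prod>i\<in>{1..n}. emeasure (density lborel (\<lambda>y. ennreal (f y))) (A i))" .
  qed (auto intro!: sets_PiM_cong)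
qed

lemma estimator_event_measurable:
  assumes T: "T \<in> estimators n" and f: "f \<in> L2" and "0 \<le> r"
  shows "{X \<in> space (\<Pi>\<^sub>M i\<in>{1..n}. borel). r < (L2_norm (\<lambda>y. T X y - f y))\<^sup>2}
    \<in> sets (\<Pi>\<^sub>M i\<in>{1..n}. borel)"
proof -
  have T': "T \<in> (\<Pi>\<^sub>M i\<in>{1..n}. borel) \<rightarrow>\<^sub>M L2_borel" using T by (simp add: estimators_def)
  have "T -` {h \<in> L2. r < (L2_norm (\<lambda>y. h y - f y))\<^sup>2} \<inter> space (\<Pi>\<^sub>M i\<in>{1..n}. borel)
    \<in> sets (\<Pi>\<^sub>M i\<in>{1..n}. borel)"
    by (rule measurable_sets[OF T' L2_borel_outside_ball]) fact+
  also have "T -` {h \<in> L2. r < (L2_norm (\<lambda>y. h y - f y))\<^sup>2} \<inter> space (\<Pi>\<^sub>M i\<in>{1..n}. borel)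
    = {X \<in> space (\<Pi>\<^sub>M i\<in>{1..n}. borel). r < (L2_norm (\<lambda>y. T X y - f y))\<^sup>2}"
    using measurable_space[OF T'] by (auto simp: space_L2_borel)
  finally show ?thesis .
qed

section \<open>Disjoint cells of prescribed volume\<close>

text \<open>Open cubes are lined up along the axis \<open>e\<close>: the cells at nonnegative
  multiples of their side length, \<open>C\<close> on the negative side. Disjointness can then be
  read off from the coordinate \<open>y \<bullet> e\<close> alone.\<close>

lemma disjoint_boxes:
  fixes v w :: real
  assumes v: "0 \<le> v" and w: "0 \<le> w"
  obtains C :: "'a::euclidean_space set" and S :: "nat \<Rightarrow> bool \<Rightarrow> 'a set"
  where "C \<in> sets borel" "emeasure lborel C = ennreal w"
    "\<And>k b. S k b \<in> sets borel" "\<And>k b. emeasure lborel (S k b) = ennreal v"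
    "\<And>k b. C \<inter> S k b = {}" "\<And>k b k' b'. (k, b) \<noteq> (k', b') \<Longrightarrow> S k b \<inter> S k' b' = {}"
proof -
  obtain e :: 'a where e: "e \<in> Basis" using nonempty_Basis by blast
  have cube: "emeasure lborel (box (a::'a) (a + root DIM('a) t *\<^sub>R One)) = ennreal t" if "0 \<le> t" for a t
  proof -
    have "emeasure lborel (box a (a + root DIM('a) t *\<^sub>R One))
      = ennreal (\<Prod>b\<in>Basis. (root DIM('a) t *\<^sub>R (One::'a)) \<bullet> b)"
      using that by (subst emeasure_lborel_box) (auto simp: inner_simps)
    also have "(\<Prod>b\<in>Basis. (root DIM('a) t *\<^sub>R (One::'a)) \<bullet> b) = t"
      using that by simp
    finally show ?thesis .
  qed
  define c where "c = root DIM('a) v"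
  have c: "0 \<le> c" using v by (simp add: c_def)
  define B where "B m = box ((real m * c) *\<^sub>R e) ((real m * c) *\<^sub>R e + c *\<^sub>R One)" for m
  have B_slab: "real m * c < y \<bullet> e \<and> y \<bullet> e < real (Suc m) * c" if "y \<in> B m" for y m
    using that e by (auto simp: B_def mem_box inner_simps algebra_simps inner_Basis dest!: bspec[of _ _ e])
  have B_disj: "m = m'" if "y \<in> B m" "y \<in> B m'" for y m m'
  proof (rule ccontr)
    assume "m \<noteq> m'"
    then consider "Suc m \<le> m'" | "Suc m' \<le> m" by linarith
    then show False
    proof cases
      case 1
      then have "real (Suc m) * c \<le> real m' * c" using c by (intro mult_right_mono) auto
      then show False using B_slab[OF that(1)] B_slab[OF that(2)] by linarith
    next
      case 2
      then have "real (Suc m') * c \<le> real m * c" using c by (intro mult_right_mono) auto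
      then show False using B_slab[OF that(1)] B_slab[OF that(2)] by linarith
    qed
  qed
  define C where "C = box (- (root DIM('a) w *\<^sub>R (One::'a))) (- (root DIM('a) w *\<^sub>R One) + root DIM('a) w *\<^sub>R One)"
  have C_slab: "y \<bullet> e < 0" if "y \<in> C" for y
    using that e by (auto simp: C_def mem_box dest!: bspec[of _ _ e])
  show thesis
  \<comment> \<open>The pairs \<open>(k, b)\<close> are numbered injectively: even numbers for
    \<open>False\<close>, odd ones for \<open>True\<close>.\<close>
  proof (rule that[of C "\<lambda>k b. B (2 * k + of_bool b)"])
    show "emeasure lborel C = ennreal w" unfolding C_def using cube[OF w] .
    show "emeasure lborel (B (2 * k + of_bool b)) = ennreal v" for k b
      unfolding B_def c_def using cube[OF v] .
    show "C \<inter> B (2 * k + of_bool b) = {}" for k b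
    proof -
      have "\<not> real m * c < y \<bullet> e" if "y \<in> C" for y m
        using C_slab[OF that] c by (smt (verit) mult_nonneg_nonneg of_nat_0_le_iff)
      then show ?thesis using B_slab by blast
    qed
    show "B (2 * k + of_bool b) \<inter> B (2 * k' + of_bool b') = {}" if "(k, b) \<noteq> (k', b')" for k b k' b'
    proof -
      have "2 * k + of_bool b \<noteq> 2 * k' + of_bool b'" using that by (cases b; cases b'; simp; presburger)
      then show ?thesis using B_disj by blast
    qed
  qed (auto simp: C_def B_def)
qed

section \<open>The flipping argument\<close>

text \<open>Symmetric difference with \<open>J\<close> is an involution of \<open>Pow I\<close>, so
  reindexing along it does not change the sum of \<open>a \<omega> * w \<omega>\<close>. Adding the
  two copies weights each \<open>w \<omega>\<close> by at least 1. Later \<open>a\<close> indicates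
  an error and \<open>w\<close> is the likelihood.\<close>

lemma sum_symmetric_difference_ge:
  fixes a w :: "'k set \<Rightarrow> ennreal"
  assumes J: "J \<subseteq> I"
    and w: "\<And>\<omega>. \<omega> \<subseteq> I \<Longrightarrow> w (sym_diff \<omega> J) = w \<omega>"
    and a: "\<And>\<omega>. \<omega> \<subseteq> I \<Longrightarrow> 1 \<le> a \<omega> + a (sym_diff \<omega> J)"
  shows "(\<Sum>\<omega>\<in>Pow I. w \<omega>) \<le> 2 * (\<Sum>\<omega>\<in>Pow I. a \<omega> * w \<omega>)"
proof -
  have bij: "bij_betw (\<lambda>\<omega>. sym_diff \<omega> J) (Pow I) (Pow I)"
    by (rule bij_betwI[where g = "\<lambda>\<omega>. sym_diff \<omega> J"]) (use J in auto)
  have "(\<Sum>\<omega>\<in>Pow I. w \<omega>) \<le> (\<Sum>\<omega>\<in>Pow I. (a \<omega> + a (sym_diff \<omega> J)) * w \<omega>)"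
  proof (rule sum_mono)
    fix \<omega> assume "\<omega> \<in> Pow I"
    then have "1 * w \<omega> \<le> (a \<omega> + a (sym_diff \<omega> J)) * w \<omega>"
      using a by (intro mult_right_mono) auto
    then show "w \<omega> \<le> (a \<omega> + a (sym_diff \<omega> J)) * w \<omega>" by simp
  qed
  also have "\<dots> = (\<Sum>\<omega>\<in>Pow I. a \<omega> * w \<omega> + a (sym_diff \<omega> J) * w (sym_diff \<omega> J))"
    by (intro sum.cong refl) (use w in \<open>simp add: distrib_right\<close>)
  also have "\<dots> = (\<Sum>\<omega>\<in>Pow I. a \<omega> * w \<omega>) + (\<Sum>\<omega>\<in>Pow I. a \<omega> * w \<omega>)"
    unfolding sum.distrib using sum.reindex_bij_betw[OF bij, of "\<lambda>\<omega>. a \<omega> * w \<omega>"] by simp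
  finally show ?thesis by (simp add: mult_2)
qed

text \<open>The random set \<open>J\<close> of coordinates about which the sample is silent;
  \<open>Q k\<close> is the block belonging to coordinate \<open>k\<close>.\<close>

definition unobserved :: "nat \<Rightarrow> nat \<Rightarrow> (nat \<Rightarrow> 'a set) \<Rightarrow> (nat \<Rightarrow> 'a) \<Rightarrow> nat set" where
  "unobserved K n Q X = {k. k < K \<and> (\<forall>i\<in>{1..n}. X i \<notin> Q k)}"

lemma finite_unobserved [simp]: "finite (unobserved K n Q X)"
  by (simp add: unobserved_def)

lemma unobserved_measurable [measurable]:
  fixes Q :: "nat \<Rightarrow> 'a::euclidean_space set"
  assumes [measurable]: "\<And>k. Q k \<in> sets borel"
  shows "(\<lambda>X. card (unobserved K n Q X)) \<in> (\<Pi>\<^sub>M i\<in>{1..n}. borel) \<rightarrow>\<^sub>M count_space UNIV"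
proof -
  \<comment> \<open>As a finite sum of indicators of measurable events the cardinality is
    measurable.\<close>
  have "card (unobserved K n Q X) = (\<Sum>k<K. if \<forall>i\<in>{1..n}. X i \<notin> Q k then 1 else 0)" for X
  proof -
    have "unobserved K n Q X = {k\<in>{..<K}. \<forall>i\<in>{1..n}. X i \<notin> Q k}" by (auto simp: unobserved_def)
    then show ?thesis by (simp add: sum.If_cases Int_def)
  qed
  then show ?thesis by simp
qed

text \<open>If both squared distances were at most \<open>r\<close>, the triangle inequality with
  weight 1 would bound the separation of \<open>f\<close> and \<open>g\<close> by
  \<open>2 * r + 2 * r\<close>.\<close>

lemma L2_norm_sq_far_from_one:
  assumes "t \<in> L2" "f \<in> L2" "g \<in> L2" and "4 * r < (L2_norm (\<lambda>y. f y - g y))\<^sup>2"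
  shows "r < (L2_norm (\<lambda>y. t y - f y))\<^sup>2 \<or> r < (L2_norm (\<lambda>y. t y - g y))\<^sup>2"
proof -
  have "(L2_norm (\<lambda>y. f y - g y))\<^sup>2
    \<le> (1 + 1) * (L2_norm (\<lambda>y. f y - t y))\<^sup>2 + (1 + 1 / 1) * (L2_norm (\<lambda>y. t y - g y))\<^sup>2"
    by (rule L2_norm_sq_diff_le) (use assms in auto)
  then show ?thesis using assms L2_norm_commute[of f t] by auto
qed

text \<open>A Bayes argument with the uniform prior on the hypercube, where the flipped set depends
  on the sample. For each sample with at least \<open>u\<close> unobserved coordinates, flipping
  pairs hypotheses of equal likelihood that are too far apart for \<open>T X\<close> to be close to
  both. Integrating over samples and averaging over \<omega> costs a factor 2.\<close>

lemma flip_lower_bound: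
  fixes f :: "nat set \<Rightarrow> 'a::euclidean_space \<Rightarrow> real" and Q :: "nat \<Rightarrow> 'a set"
  assumes dens: "\<And>\<omega>. \<omega> \<subseteq> {..<K} \<Longrightarrow> f \<omega> \<in> bounded_densities L"
    and Q [measurable]: "\<And>k. Q k \<in> sets borel"
    and flip: "\<And>\<omega> J y. \<lbrakk>\<omega> \<subseteq> {..<K}; J \<subseteq> {..<K}; y \<notin> (\<Union>k\<in>J. Q k)\<rbrakk> \<Longrightarrow> f (sym_diff \<omega> J) y = f \<omega> y"
    and sep: "\<And>\<omega> J. \<lbrakk>\<omega> \<subseteq> {..<K}; J \<subseteq> {..<K}\<rbrakk>
        \<Longrightarrow> c * real (card J) \<le> (L2_norm (\<lambda>y. f \<omega> y - f (sym_diff \<omega> J) y))\<^sup>2"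
    and c: "0 \<le> c" and r: "0 \<le> r" "4 * r < c * real u"
    and T: "T \<in> estimators n"
    and p: "\<And>\<omega>. \<omega> \<subseteq> {..<K} \<Longrightarrow>
        p \<le> measure (iid_law n (f \<omega>)) {X \<in> space (iid_law n (f \<omega>)). u \<le> card (unobserved K n Q X)}"
  obtains \<omega> where "\<omega> \<subseteq> {..<K}"
    "p / 2 \<le> measure (iid_law n (f \<omega>))
      {X \<in> space (iid_law n (f \<omega>)). r < (L2_norm (\<lambda>y. T X y - f \<omega> y))\<^sup>2}"
proof -
  define B :: "(nat \<Rightarrow> 'a) measure" where "B = (\<Pi>\<^sub>M i\<in>{1..n}. borel)"
  define \<mu> :: "(nat \<Rightarrow> 'a) measure" where "\<mu> = (\<Pi>\<^sub>M i\<in>{1..n}. lborel)"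
  define G where "G = {X \<in> space B. u \<le> card (unobserved K n Q X)}"
  define E where "E \<omega> = {X \<in> space B. r < (L2_norm (\<lambda>y. T X y - f \<omega> y))\<^sup>2}" for \<omega>
  define w where "w \<omega> X = (\<Prod>i=1..n. ennreal (f \<omega> (X i)))" for \<omega> X
  have space_iid: "space (iid_law n (f \<omega>)) = space B" for \<omega>
    unfolding B_def by (rule sets_eq_imp_space_eq[OF sets_iid_law])
  have sets_\<mu>: "sets \<mu> = sets B" unfolding \<mu>_def B_def by (intro sets_PiM_cong) auto
  then have space_\<mu>: "space \<mu> = space B" by (rule sets_eq_imp_space_eq)
  have L2: "f \<omega> \<in> L2" if "\<omega> \<subseteq> {..<K}" for \<omega>
    using dens[OF that] bounded_densities_subset_L2 by blast
  have G: "G \<in> sets B" unfolding G_def B_def by measurable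
  have E: "E \<omega> \<in> sets B" if "\<omega> \<subseteq> {..<K}" for \<omega>
    unfolding E_def B_def by (rule estimator_event_measurable[OF T L2[OF that] r(1)])
  have w: "w \<omega> \<in> borel_measurable \<mu>" if "\<omega> \<subseteq> {..<K}" for \<omega>
  proof -
    have [measurable]: "f \<omega> \<in> borel_measurable lborel"
      using dens[OF that] by (auto simp: bounded_densities_def)
    show ?thesis unfolding w_def \<mu>_def by measurable
  qed
  have iid: "emeasure (iid_law n (f \<omega>)) A = (\<integral>\<^sup>+X. indicator A X * w \<omega> X \<partial>\<mu>)"
    if "\<omega> \<subseteq> {..<K}" "A \<in> sets B" for \<omega> A
  proof -
    have "iid_law n (f \<omega>) = density \<mu> (w \<omega>)"
      unfolding iid_law_eq_density[OF dens[OF that(1)]] \<mu>_def w_def ..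
    then show ?thesis
      using that w[OF that(1)] by (simp add: emeasure_density sets_\<mu> mult.commute)
  qed
  have meas: "(\<lambda>X. indicator (E \<omega>) X * w \<omega> X) \<in> borel_measurable \<mu>" if "\<omega> \<subseteq> {..<K}" for \<omega>
    using E[OF that] w[OF that] sets_\<mu> by (intro borel_measurable_times_ennreal borel_measurable_indicator) auto
  have T_L2: "T X \<in> L2" if "X \<in> space B" for X
    using measurable_space[of T B L2_borel] T that by (simp add: estimators_def B_def space_L2_borel)
  \<comment> \<open>For a fixed sample \<open>X\<close> the set \<open>J\<close> is fixed, so the
    combinatorial inequality applies with the likelihoods as weights. Off \<open>G\<close> the
    left-hand side is zero.\<close>
  have pointwise: "(\<Sum>\<omega>\<in>Pow {..<K}. indicator G X * w \<omega> X)
      \<le> 2 * (\<Sum>\<omega>\<in>Pow {..<K}. indicator (E \<omega>) X * w \<omega> X)" if X: "X \<in> space \<mu>" for X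
  proof (cases "X \<in> G")
    case True
    define J where "J = unobserved K n Q X"
    have J: "J \<subseteq> {..<K}" by (auto simp: J_def unobserved_def)
    have "(\<Sum>\<omega>\<in>Pow {..<K}. w \<omega> X) \<le> 2 * (\<Sum>\<omega>\<in>Pow {..<K}. indicator (E \<omega>) X * w \<omega> X)"
    proof (rule sum_symmetric_difference_ge[OF J])
      fix \<omega> assume \<omega>: "\<omega> \<subseteq> {..<K}"
      show "w (sym_diff \<omega> J) X = w \<omega> X" unfolding w_def
        by (intro prod.cong refl arg_cong[where f = ennreal] flip[OF \<omega> J]) (auto simp: J_def unobserved_def)
      have \<omega>': "sym_diff \<omega> J \<subseteq> {..<K}" using \<omega> J by auto
      have "c * real u \<le> c * real (card J)"
        using True c by (intro mult_left_mono) (auto simp: G_def J_def)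
      then have "4 * r < (L2_norm (\<lambda>y. f \<omega> y - f (sym_diff \<omega> J) y))\<^sup>2"
        using sep[OF \<omega> J] r by linarith
      from L2_norm_sq_far_from_one[OF T_L2 L2[OF \<omega>] L2[OF \<omega>'] this, of X] X
      have "X \<in> E \<omega> \<or> X \<in> E (sym_diff \<omega> J)"
        by (auto simp: E_def space_\<mu>)
      then show "1 \<le> indicator (E \<omega>) X + (indicator (E (sym_diff \<omega> J)) X :: ennreal)"
        by (auto simp: indicator_def)
    qed
    then show ?thesis using True by simp
  qed simp
  have "(\<Sum>\<omega>\<in>Pow {..<K}. emeasure (iid_law n (f \<omega>)) G)
    = (\<integral>\<^sup>+X. (\<Sum>\<omega>\<in>Pow {..<K}. indicator G X * w \<omega> X) \<partial>\<mu>)"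
    using G w sets_\<mu> by (subst nn_integral_sum) (auto simp: iid)
  also have "\<dots> \<le> (\<integral>\<^sup>+X. 2 * (\<Sum>\<omega>\<in>Pow {..<K}. indicator (E \<omega>) X * w \<omega> X) \<partial>\<mu>)"
    by (intro nn_integral_mono pointwise)
  also have "\<dots> = 2 * (\<integral>\<^sup>+X. (\<Sum>\<omega>\<in>Pow {..<K}. indicator (E \<omega>) X * w \<omega> X) \<partial>\<mu>)"
    by (intro nn_integral_cmult borel_measurable_sum meas) auto
  also have "(\<integral>\<^sup>+X. (\<Sum>\<omega>\<in>Pow {..<K}. indicator (E \<omega>) X * w \<omega> X) \<partial>\<mu>)
    = (\<Sum>\<omega>\<in>Pow {..<K}. \<integral>\<^sup>+X. indicator (E \<omega>) X * w \<omega> X \<partial>\<mu>)"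
    by (intro nn_integral_sum meas) auto
  also have "\<dots> = (\<Sum>\<omega>\<in>Pow {..<K}. emeasure (iid_law n (f \<omega>)) (E \<omega>))"
    by (intro sum.cong refl) (use E in \<open>simp add: iid\<close>)
  finally have le: "(\<Sum>\<omega>\<in>Pow {..<K}. emeasure (iid_law n (f \<omega>)) G)
    \<le> 2 * (\<Sum>\<omega>\<in>Pow {..<K}. emeasure (iid_law n (f \<omega>)) (E \<omega>))" .
  \<comment> \<open>All measures are finite, so the inequality can be moved to the reals, where the
    averages are compared.\<close>
  have em: "emeasure (iid_law n (f \<omega>)) A = ennreal (measure (iid_law n (f \<omega>)) A)" if "\<omega> \<in> Pow {..<K}" for \<omega> A
  proof -
    interpret prob_space "iid_law n (f \<omega>)" using that by (intro iid_law_prob_space[OF dens]) auto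
    show ?thesis by (rule emeasure_eq_measure)
  qed
  have "ennreal (\<Sum>\<omega>\<in>Pow {..<K}. measure (iid_law n (f \<omega>)) G)
    \<le> ennreal (2 * (\<Sum>\<omega>\<in>Pow {..<K}. measure (iid_law n (f \<omega>)) (E \<omega>)))"
    using le by (simp add: em ennreal_mult sum_nonneg)
  then have le': "(\<Sum>\<omega>\<in>Pow {..<K}. measure (iid_law n (f \<omega>)) G)
    \<le> 2 * (\<Sum>\<omega>\<in>Pow {..<K}. measure (iid_law n (f \<omega>)) (E \<omega>))"
    by (simp add: sum_nonneg)
  \<comment> \<open>Otherwise the \<open>2 ^ K\<close> error probabilities would sum to less than
    \<open>2 ^ K * p / 2\<close>, against \<open>le'\<close> and the bound \<open>p\<close> on each
    probability of \<open>G\<close>.\<close>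
  have "\<exists>\<omega>\<in>Pow {..<K}. p / 2 \<le> measure (iid_law n (f \<omega>)) (E \<omega>)"
  proof (rule ccontr)
    assume none: "\<not> ?thesis"
    have lt: "measure (iid_law n (f \<omega>)) (E \<omega>) < p / 2" if "\<omega> \<in> Pow {..<K}" for \<omega>
      using none that by (meson not_le)
    have "(\<Sum>\<omega>\<in>Pow {..<K}. measure (iid_law n (f \<omega>)) (E \<omega>)) < (\<Sum>\<omega>\<in>Pow {..<K}. p / 2)"
      by (intro sum_strict_mono lt) auto
    also have "2 * \<dots> \<le> (\<Sum>\<omega>\<in>Pow {..<K}. measure (iid_law n (f \<omega>)) G)"
    proof -
      have "(\<Sum>\<omega>\<in>Pow {..<K}. p) \<le> (\<Sum>\<omega>\<in>Pow {..<K}. measure (iid_law n (f \<omega>)) G)"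
        using p by (intro sum_mono) (auto simp: G_def space_iid)
      then show ?thesis by simp
    qed
    finally show False using le' by simp
  qed
  then obtain \<omega> where "\<omega> \<in> Pow {..<K}" "p / 2 \<le> measure (iid_law n (f \<omega>)) (E \<omega>)" by (rule bexE)
  then show thesis by (intro that[of \<omega>]) (simp_all add: E_def space_iid)
qed

section \<open>Probability that coordinates stay unobserved\<close>

text \<open>With one coordinate the event is a box: all \<open>n\<close> independent draws miss
  \<open>Q 0\<close>.\<close>

lemma unobserved_single:
  fixes Q :: "nat \<Rightarrow> 'a::euclidean_space set"
  assumes f: "f \<in> bounded_densities L" and Q [measurable]: "\<And>k. Q k \<in> sets borel"
    and q: "measure (density lborel (\<lambda>y. ennreal (f y))) (Q 0) = s"
  shows "measure (iid_law n f) {X \<in> space (iid_law n f). 1 \<le> card (unobserved 1 n Q X)} = (1 - s) ^ n"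
proof -
  interpret D: prob_space "density lborel (\<lambda>y. ennreal (f y))" by (rule density_prob_space) fact
  have sp: "space (iid_law n f) = Pi\<^sub>E {1..n} (\<lambda>_. UNIV)"
    by (simp add: iid_law_def space_PiM)
  have "1 \<le> card (unobserved 1 n Q X) \<longleftrightarrow> (\<forall>i\<in>{1..n}. X i \<notin> Q 0)" for X
    by (auto simp: Suc_le_eq card_gt_0_iff unobserved_def)
  then have "{X \<in> space (iid_law n f). 1 \<le> card (unobserved 1 n Q X)} = Pi\<^sub>E {1..n} (\<lambda>_. - Q 0)"
    unfolding sp by (auto simp: PiE_iff extensional_def)
  moreover have "emeasure (iid_law n f) (Pi\<^sub>E {1..n} (\<lambda>_. - Q 0)) = ennreal ((1 - s) ^ n)"
  proof -
    have "D.prob (- Q 0) = 1 - s"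
      using D.prob_compl[of "Q 0"] q by (simp add: Compl_eq_Diff_UNIV)
    moreover have "0 \<le> 1 - s" using D.prob_le_1[of "Q 0"] q by simp
    ultimately show ?thesis
      by (subst emeasure_iid_law_PiE[OF f]) (auto simp: D.emeasure_eq_measure ennreal_power)
  qed
  moreover have "0 \<le> 1 - s" using D.prob_le_1[of "Q 0"] q by simp
  ultimately show ?thesis by (simp add: measure_def)
qed

text \<open>A union bound over the draws shows that a given coordinate is observed with probability
  at most \<open>n * \<delta>\<close>; Markov's inequality for the number of observed coordinates
  does the rest.\<close>

lemma unobserved_half:
  fixes Q :: "nat \<Rightarrow> 'a::euclidean_space set"
  assumes f: "f \<in> bounded_densities L" and Q [measurable]: "\<And>k. Q k \<in> sets borel"
    and q: "\<And>k. k < K \<Longrightarrow> measure (density lborel (\<lambda>y. ennreal (f y))) (Q k) \<le> \<delta>"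
    and \<delta>: "0 \<le> \<delta>" and u: "2 * u \<le> K + 1"
  shows "1 - 2 * real n * \<delta> \<le> measure (iid_law n f) {X \<in> space (iid_law n f). u \<le> card (unobserved K n Q X)}"
proof -
  let ?P = "iid_law n f"
  interpret D: prob_space "density lborel (\<lambda>y. ennreal (f y))" by (rule density_prob_space) fact
  interpret P: prob_space ?P by (rule iid_law_prob_space) fact
  have Qk: "P.prob {X \<in> space ?P. X i \<in> Q k} \<le> \<delta>" if "i \<in> {1..n}" "k < K" for i k
  proof -
    have sp: "space ?P = Pi\<^sub>E {1..n} (\<lambda>_. UNIV)"
      by (simp add: iid_law_def space_PiM)
    \<comment> \<open>A box with only the \<open>i\<close>-th side constrained, which yields the
      marginal law of the \<open>i\<close>-th draw.\<close>
    have "{X \<in> space ?P. X i \<in> Q k} = Pi\<^sub>E {1..n} (\<lambda>j. if j = i then Q k else UNIV)"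
      unfolding sp using that by (auto simp: PiE_iff extensional_def split: if_splits)
    moreover have "emeasure ?P (Pi\<^sub>E {1..n} (\<lambda>j. if j = i then Q k else UNIV))
      = ennreal (D.prob (Q k))"
    proof -
      have "emeasure ?P (Pi\<^sub>E {1..n} (\<lambda>j. if j = i then Q k else UNIV))
        = (\<Prod>j=1..n. emeasure (density lborel (\<lambda>y. ennreal (f y))) (if j = i then Q k else UNIV))"
        by (rule emeasure_iid_law_PiE[OF f]) auto
      also have "\<dots> = (\<Prod>j=1..n. if j = i then emeasure (density lborel (\<lambda>y. ennreal (f y))) (Q k) else 1)"
        by (intro prod.cong refl) (use D.emeasure_space_1 in auto)
      finally show ?thesis using that by (simp add: D.emeasure_eq_measure)
    qed
    ultimately show ?thesis using q[OF that(2)] by (simp add: measure_def)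
  qed
  define H where "H k = (\<Union>i\<in>{1..n}. {X \<in> space ?P. X i \<in> Q k})" for k
  define U where "U = {X \<in> space ?P. u \<le> card (unobserved K n Q X)}"
  have [measurable]: "U \<in> P.events" "H k \<in> P.events" for k
    unfolding U_def H_def by measurable
  have "P.prob (H k) \<le> real n * \<delta>" if "k < K" for k
  proof -
    have "P.prob (H k) \<le> (\<Sum>i\<in>{1..n}. P.prob {X \<in> space ?P. X i \<in> Q k})"
      unfolding H_def by (rule P.finite_measure_subadditive_finite) auto
    also have "\<dots> \<le> (\<Sum>i\<in>{1..n}. \<delta>)" by (intro sum_mono Qk that)
    finally show ?thesis by simp
  qed
  then have "(\<Sum>k<K. P.prob (H k)) \<le> (\<Sum>k<K. real n * \<delta>)" by (intro sum_mono) auto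
  \<comment> \<open>Markov's inequality: outside \<open>U\<close> at most \<open>u - 1\<close>
    coordinates are unobserved, so by \<open>2 * u \<le> K + 1\<close> at least
    \<open>(K + 1) / 2\<close> are observed.\<close>
  moreover have "(real K + 1) / 2 * P.prob (space ?P - U) \<le> (\<Sum>k<K. P.prob (H k))"
  proof -
    have "(real K + 1) / 2 * P.prob (space ?P - U)
      = (\<integral>X. (real K + 1) / 2 * indicator (space ?P - U) X \<partial>?P)" by simp
    also have "\<dots> \<le> (\<integral>X. (\<Sum>k<K. indicator (H k) X) \<partial>?P)"
    proof (rule integral_mono)
      fix X assume X: "X \<in> space ?P"
      have "(\<Sum>k<K. indicator (H k) X) = real (card ({..<K} - unobserved K n Q X))"
      proof -
        have "{..<K} - unobserved K n Q X = {k\<in>{..<K}. X \<in> H k}"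
          using X by (auto simp: H_def unobserved_def)
        then show ?thesis by (simp add: indicator_def sum.If_cases Int_def)
      qed
      also have "card ({..<K} - unobserved K n Q X) = K - card (unobserved K n Q X)"
        by (subst card_Diff_subset) (auto simp: unobserved_def)
      finally show "(real K + 1) / 2 * indicator (space ?P - U) X \<le> (\<Sum>k<K. indicator (H k) X :: real)"
        using u X by (auto simp: indicator_def U_def not_le)
    qed (intro integrable_mult_right Bochner_Integration.integrable_sum integrable_real_indicator;
        auto simp: less_top[symmetric])+
    also have "\<dots> = (\<Sum>k<K. P.prob (H k))"
      by (subst Bochner_Integration.integral_sum) (auto simp: less_top[symmetric])
    finally show ?thesis .
  qed
  ultimately have "(real K + 1) / 2 * P.prob (space ?P - U) \<le> real K * (real n * \<delta>)" by simp
  also have "\<dots> \<le> (real K + 1) * (real n * \<delta>)" using \<delta> by (intro mult_right_mono) auto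
  also have "\<dots> = (real K + 1) / 2 * (2 * real n * \<delta>)" by simp
  finally have "P.prob (space ?P - U) \<le> 2 * real n * \<delta>"
    by (rule mult_left_le_imp_le) simp
  then show ?thesis using P.prob_compl[of U] by (simp add: U_def)
qed

section \<open>The hypercube of densities\<close>

text \<open>Each coordinate selects one of two cells of equal volume. Hence the total mass and the
  mass of every block are independent of \<omega>, while a flip of coordinate \<open>k\<close>
  changes the density on \<open>Q k\<close> only.\<close>

lemma hypercube_of_densities:
  fixes L s :: real and K :: nat
  assumes L: "0 < L" and s: "0 \<le> s" "s \<le> 1" and K: "0 < K"
  obtains f :: "nat set \<Rightarrow> 'a::euclidean_space \<Rightarrow> real" and Q :: "nat \<Rightarrow> 'a set"
  where "\<And>\<omega>. f \<omega> \<in> bounded_densities L"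
    "\<And>k. Q k \<in> sets borel"
    "\<And>\<omega> k. k < K \<Longrightarrow> measure (density lborel (\<lambda>y. ennreal (f \<omega> y))) (Q k) = s / K"
    "\<And>\<omega> J y. y \<notin> (\<Union>k\<in>J. Q k) \<Longrightarrow> f (sym_diff \<omega> J) y = f \<omega> y"
    "\<And>\<omega> J. J \<subseteq> {..<K} \<Longrightarrow>
      (L2_norm (\<lambda>y. f \<omega> y - f (sym_diff \<omega> J) y))\<^sup>2 = 2 * s * L / K * card J"
proof -
  have "0 \<le> s / (L * K)" "0 \<le> (1 - s) / L" using L s by auto
  from disjoint_boxes[OF this] obtain C :: "'a set" and S :: "nat \<Rightarrow> bool \<Rightarrow> 'a set"
    where [measurable]: "C \<in> sets borel" "\<And>k b. S k b \<in> sets borel"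
      and C: "emeasure lborel C = ennreal ((1 - s) / L)"
      and S: "\<And>k b. emeasure lborel (S k b) = ennreal (s / (L * K))"
      and CS: "\<And>k b. C \<inter> S k b = {}"
      and SS: "\<And>k b k' b'. (k, b) \<noteq> (k', b') \<Longrightarrow> S k b \<inter> S k' b' = {}"
    by metis
  define A where "A \<omega> = C \<union> (\<Union>k<K. S k (k \<in> \<omega>))" for \<omega>
  define f where "f \<omega> y = L * indicator (A \<omega>) y" for \<omega> y
  define Q where "Q k = S k True \<union> S k False" for k
  have SS_eq: "k = k' \<and> b = b'" if "y \<in> S k b" "y \<in> S k' b'" for y k b k' b'
  proof (rule ccontr)
    assume "\<not> ?thesis"
    then have "S k b \<inter> S k' b' = {}" by (intro SS) simp
    with that show False by blast
  qed
  have A [measurable]: "A \<omega> \<in> sets borel" for \<omega> unfolding A_def by measurable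
  have Q [measurable]: "Q k \<in> sets borel" for k unfolding Q_def by measurable
  \<comment> \<open>The cells are disjoint, so on a cell of coordinate \<open>k\<close> only the bit
    \<open>k \<in> \<omega>\<close> decides.\<close>
  have mem_A: "y \<in> A \<omega> \<longleftrightarrow> (k \<in> \<omega>) = b" if "y \<in> S k b" "k < K" for y k b \<omega>
  proof -
    have "y \<notin> C" using CS that by blast
    then have "y \<in> A \<omega> \<longleftrightarrow> (\<exists>k'<K. y \<in> S k' (k' \<in> \<omega>))" by (auto simp: A_def)
    also have "\<dots> \<longleftrightarrow> (k \<in> \<omega>) = b"
    proof
      assume "\<exists>k'<K. y \<in> S k' (k' \<in> \<omega>)"
      then obtain k' where k': "y \<in> S k' (k' \<in> \<omega>)" by blast
      with that(1) have "(k, b) = (k', k' \<in> \<omega>)" using SS_eq[of y k b k' "k' \<in> \<omega>"] by simp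
      then show "(k \<in> \<omega>) = b" by simp
    next
      assume "(k \<in> \<omega>) = b"
      with that have "k < K \<and> y \<in> S k (k \<in> \<omega>)" by simp
      then show "\<exists>k'<K. y \<in> S k' (k' \<in> \<omega>)" by (rule exI)
    qed
    finally show ?thesis .
  qed
  have Kd: "ennreal (\<Sum>k<K. s / (L * K)) = ennreal (s / L)" using K by (simp add: field_simps)
  have eA: "emeasure lborel (A \<omega>) = ennreal (1 / L)" for \<omega>
  proof -
    have "emeasure lborel (\<Union>k<K. S k (k \<in> \<omega>)) = (\<Sum>k<K. emeasure lborel (S k (k \<in> \<omega>)))"
      by (intro sum_emeasure[symmetric]) (auto simp: disjoint_family_on_def dest: SS_eq)
    also have "\<dots> = ennreal (s / L)"
      using Kd L s by (simp add: S sum_ennreal del: sum_constant)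
    finally have "emeasure lborel (A \<omega>) = ennreal ((1 - s) / L) + ennreal (s / L)"
      unfolding A_def using CS by (subst plus_emeasure[symmetric]) (auto simp: C)
    also have "\<dots> = ennreal (1 / L)"
      using L s by (subst ennreal_plus[symmetric]) (auto simp: field_simps)
    finally show ?thesis .
  qed
  have f_meas [measurable]: "f \<omega> \<in> borel_measurable lborel" for \<omega>
    unfolding f_def by measurable
  have ennreal_f: "ennreal (f \<omega> y) = ennreal L * indicator (A \<omega>) y" for \<omega> y
    by (simp add: f_def indicator_def)
  have f_le: "\<bar>f \<omega> y\<bar> \<le> L" for \<omega> y using L by (simp add: f_def indicator_def)
  have dens: "f \<omega> \<in> bounded_densities L" for \<omega>
  proof -
    have "(\<integral>\<^sup>+ y. ennreal (f \<omega> y) \<partial>lborel) = 1"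
      using L by (simp add: ennreal_f nn_integral_cmult_indicator eA ennreal_mult[symmetric])
    moreover have "Linf_norm (f \<omega>) \<le> ereal L"
      unfolding Linf_norm_def by (rule esssup_I) (use f_le in auto)
    ultimately show ?thesis using L by (simp add: bounded_densities_def f_def)
  qed
  have mass: "measure (density lborel (\<lambda>y. ennreal (f \<omega> y))) (Q k) = s / K" if k: "k < K" for \<omega> k
  proof -
    \<comment> \<open>Exactly one cell of the block lies in the support, with mass
      \<open>L * (s / (L * K)) = s / K\<close>.\<close>
    have AQ: "A \<omega> \<inter> Q k = S k (k \<in> \<omega>)"
    proof (intro equalityI subsetI)
      fix y assume "y \<in> A \<omega> \<inter> Q k"
      then obtain b where "y \<in> S k b" "y \<in> A \<omega>" by (auto simp: Q_def)
      then show "y \<in> S k (k \<in> \<omega>)" using mem_A[OF \<open>y \<in> S k b\<close> k, of \<omega>] by simp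
    next
      fix y assume y: "y \<in> S k (k \<in> \<omega>)"
      then show "y \<in> A \<omega> \<inter> Q k" using mem_A[OF y k] by (cases "k \<in> \<omega>") (auto simp: Q_def)
    qed
    have "emeasure (density lborel (\<lambda>y. ennreal (f \<omega> y))) (Q k)
      = (\<integral>\<^sup>+y. ennreal L * indicator (A \<omega> \<inter> Q k) y \<partial>lborel)"
      by (subst emeasure_density) (auto simp: ennreal_f indicator_inter_arith mult.assoc)
    also have "\<dots> = ennreal (s / K)"
      using L s by (simp add: nn_integral_cmult_indicator AQ S ennreal_mult[symmetric])
    finally show ?thesis using s by (simp add: measure_def)
  qed
  have flip: "f (sym_diff \<omega> J) y = f \<omega> y" if "y \<notin> (\<Union>k\<in>J. Q k)" for \<omega> J y
  proof -
    have "y \<in> S k (k \<in> sym_diff \<omega> J) \<longleftrightarrow> y \<in> S k (k \<in> \<omega>)" for k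
      using that by (cases "k \<in> J"; cases "k \<in> \<omega>") (auto simp: Q_def)
    then show ?thesis by (simp add: f_def A_def indicator_def)
  qed
  have sep: "(L2_norm (\<lambda>y. f \<omega> y - f (sym_diff \<omega> J) y))\<^sup>2 = 2 * s * L / K * card J"
    if J: "J \<subseteq> {..<K}" for \<omega> J
  proof -
    have fin: "finite J" using J finite_subset by blast
    \<comment> \<open>On a flipped block one of the two densities equals \<open>L\<close> and the
      other vanishes; elsewhere they agree.\<close>
    have sq: "(f \<omega> y - f (sym_diff \<omega> J) y)\<^sup>2 = L\<^sup>2 * indicator (\<Union>k\<in>J. Q k) y" for y
    proof (cases "y \<in> (\<Union>k\<in>J. Q k)")
      case True
      then obtain k b where kb: "k \<in> J" "y \<in> S k b" by (auto simp: Q_def)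
      then have "k < K" using J by auto
      have "y \<in> A \<omega> \<longleftrightarrow> y \<notin> A (sym_diff \<omega> J)"
        using kb by (auto simp: mem_A[OF kb(2) \<open>k < K\<close>])
      then show ?thesis using True by (auto simp: f_def indicator_def)
    next
      case False
      then show ?thesis using flip[OF False, of \<omega>] by simp
    qed
    have "emeasure lborel (Q k) = ennreal (2 * s / (L * K))" for k
    proof -
      have "emeasure lborel (Q k) = ennreal (s / (L * K)) + ennreal (s / (L * K))"
        unfolding Q_def using SS[of k True k False] by (subst plus_emeasure[symmetric]) (auto simp: S)
      then show ?thesis using L s by (simp add: ennreal_plus[symmetric] del: ennreal_plus)
    qed
    moreover have "disjoint_family_on Q J" unfolding disjoint_family_on_def Q_def by (auto dest: SS_eq)
    ultimately have "emeasure lborel (\<Union>k\<in>J. Q k) = (\<Sum>k\<in>J. ennreal (2 * s / (L * K)))"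
      using fin by (subst sum_emeasure[symmetric]) auto
    also have "\<dots> = ennreal (\<Sum>k\<in>J. 2 * s / (L * K))"
      using L s by (intro sum_ennreal) auto
    finally have "measure lborel (\<Union>k\<in>J. Q k) = (\<Sum>k\<in>J. 2 * s / (L * K))"
      unfolding measure_def using L s by (simp only: enn2real_ennreal sum_nonneg divide_nonneg_nonneg
          mult_nonneg_nonneg less_imp_le of_nat_0_le_iff zero_le_numeral)
    then have "measure lborel (\<Union>k\<in>J. Q k) = card J * (2 * s / (L * K))" by simp
    moreover have "(L2_norm (\<lambda>y. f \<omega> y - f (sym_diff \<omega> J) y))\<^sup>2 = L\<^sup>2 * measure lborel (\<Union>k\<in>J. Q k)"
      unfolding L2_norm_sq sq by simp
    ultimately show ?thesis
      using L by (simp add: power2_eq_square)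
  qed
  show thesis by (rule that[of f Q]) (fact dens Q mass flip sep)+
qed


section \<open>Constants and the two regimes\<close>

text \<open>On \<open>[0, 3)\<close> one has \<open>exp (- (y / 8)) \<le> 1 - y / 11\<close>. The
  \<open>n\<close>-th power is thus at least \<open>exp (- (x + 2))\<close>, and
  \<open>exp 2 \<le> 9 < 12\<close>.\<close>

lemma one_minus_power_ge:
  fixes x y :: real
  assumes y: "0 \<le> y" "y < 3" and le: "real n * y \<le> 8 * x + 16"
  shows "exp (- x) / 12 \<le> (1 - y / 11) ^ n"
proof -
  \<comment> \<open>The right side exceeds 1 by \<open>y * (3 - y) / 88\<close>, because
    \<open>1 / 8 - 1 / 11 = 3 / 88\<close>; here the bound 3 enters.\<close>
  have "1 \<le> (1 - y / 11) * (1 + y / 8)"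
    using y by (auto simp: algebra_simps mult_left_mono intro: mult_left_le)
  also have "\<dots> \<le> (1 - y / 11) * exp (y / 8)"
    using y by (intro mult_left_mono exp_ge_add_one_self) auto
  finally have base: "exp (- (y / 8)) \<le> 1 - y / 11"
    by (simp add: exp_minus field_simps)
  have "exp 2 = exp (1::real) ^ 2" by (simp flip: exp_of_nat_mult)
  also have "\<dots> \<le> 3 ^ 2" using exp_le by (intro power_mono) auto
  finally have "exp (- x) / 12 \<le> exp (- x) / exp 2" by (intro divide_left_mono) auto
  also have "\<dots> = exp (- (x + 2))" by (simp add: exp_diff[symmetric])
  also have "\<dots> \<le> exp (real n * - (y / 8))" using le by simp
  also have "\<dots> = exp (- (y / 8)) ^ n" by (rule exp_of_nat_mult)
  also have "\<dots> \<le> (1 - y / 11) ^ n" using base by (intro power_mono) auto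
  finally show ?thesis .
qed

text \<open>For \<open>ln M \<le> 7 x + 16\<close> one coordinate suffices, which stays unobserved with probability of
  order \<open>exp (- x)\<close>; otherwise take about \<open>log\<^sub>2 M\<close> coordinates, half of which stay unobserved
  with probability bounded below.\<close>

lemma hard_hypercube:
  fixes M n :: nat and x L :: real
  assumes M: "2 \<le> M" and n: "1 \<le> n" and x: "0 \<le> x"
    and y3: "(ln (real M) + x) / real n < 3" and L: "0 < L"
  obtains K and f :: "nat set \<Rightarrow> 'a::euclidean_space \<Rightarrow> real"
  where "2 ^ K \<le> M" "\<And>\<omega>. f \<omega> \<in> bounded_densities L"
    "\<And>T. T \<in> estimators n \<Longrightarrow> \<exists>\<omega>\<subseteq>{..<K}. 1 / 24 * exp (- x) \<le>
      measure (iid_law n (f \<omega>)) {X \<in> space (iid_law n (f \<omega>)).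
        L / 24 * ((ln (real M) + x) / real n) < (L2_norm (\<lambda>y. T X y - f \<omega> y))\<^sup>2}"
proof -
  note witness = that
  define y where "y = (ln (real M) + x) / real n"
  have lnM: "0 < ln (real M)" using M by simp
  have y: "0 < y" "y < 3" and ny: "real n * y = ln (real M) + x"
    using lnM x n y3 by (auto simp: y_def add_pos_nonneg)
  \<comment> \<open>Common end of both regimes, with \<open>s\<close> the total mass of the blocks.
    The condition on \<open>u\<close> is \<open>4 * r < c * u\<close> for
    \<open>r = L / 24 * y\<close> and \<open>c = 2 * s * L / K\<close>; the halving in
    \<open>flip_lower_bound\<close> turns \<open>1 / 12\<close> into \<open>1 / 24\<close>.\<close>
  have main: thesis if K: "0 < K" "2 ^ K \<le> M" and s: "0 \<le> s" "s \<le> 1" and u: "L * y / 12 < s * L * u / K"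
    and p: "\<And>(f :: 'a \<Rightarrow> real) Q. \<lbrakk>f \<in> bounded_densities L; \<And>k. Q k \<in> sets borel;
        \<And>k. k < K \<Longrightarrow> measure (density lborel (\<lambda>y. ennreal (f y))) (Q k) = s / K\<rbrakk>
      \<Longrightarrow> exp (- x) / 12 \<le> measure (iid_law n f) {X \<in> space (iid_law n f). u \<le> card (unobserved K n Q X)}"
    for K u :: nat and s :: real
  proof (rule hypercube_of_densities[OF L s K(1)])
    fix f :: "nat set \<Rightarrow> 'a \<Rightarrow> real" and Q :: "nat \<Rightarrow> 'a set"
    assume dens: "\<And>\<omega>. f \<omega> \<in> bounded_densities L"
      and Q: "\<And>k. Q k \<in> sets borel"
      and mass: "\<And>\<omega> k. k < K \<Longrightarrow> measure (density lborel (\<lambda>y. ennreal (f \<omega> y))) (Q k) = s / K"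
      and flip: "\<And>\<omega> J y. y \<notin> (\<Union>k\<in>J. Q k) \<Longrightarrow> f (sym_diff \<omega> J) y = f \<omega> y"
      and sep: "\<And>\<omega> J. J \<subseteq> {..<K} \<Longrightarrow>
        (L2_norm (\<lambda>y. f \<omega> y - f (sym_diff \<omega> J) y))\<^sup>2 = 2 * s * L / K * card J"
    show thesis
    proof (rule witness[OF K(2) dens])
      fix T :: "(nat \<Rightarrow> 'a) \<Rightarrow> 'a \<Rightarrow> real" assume T: "T \<in> estimators n"
      obtain \<omega> where "\<omega> \<subseteq> {..<K}" "exp (- x) / 12 / 2 \<le> measure (iid_law n (f \<omega>))
        {X \<in> space (iid_law n (f \<omega>)). L / 24 * y < (L2_norm (\<lambda>y. T X y - f \<omega> y))\<^sup>2}"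
      proof (rule flip_lower_bound[of K f L Q "2 * s * L / K" "L / 24 * y" u T n "exp (- x) / 12"])
        show "exp (- x) / 12 \<le> measure (iid_law n (f \<omega>))
            {X \<in> space (iid_law n (f \<omega>)). u \<le> card (unobserved K n Q X)}" for \<omega>
          by (rule p[OF dens Q mass])
        show "4 * (L / 24 * y) < 2 * s * L / K * u" using u by (simp add: mult_ac)
      qed (use dens Q flip sep T L s y in auto)
      then show "\<exists>\<omega>\<subseteq>{..<K}. 1 / 24 * exp (- x) \<le> measure (iid_law n (f \<omega>))
        {X \<in> space (iid_law n (f \<omega>)).
          L / 24 * ((ln (real M) + x) / real n) < (L2_norm (\<lambda>y. T X y - f \<omega> y))\<^sup>2}"
        unfolding y_def by (intro exI[of _ \<omega>]) simp
    qed
  qed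
  show thesis
  proof (cases "ln (real M) \<le> 7 * x + 16")
    case True
    show thesis
    \<comment> \<open>With \<open>K = u = 1\<close> the separation asks for
      \<open>s > y / 12\<close>, hence \<open>s = y / 11\<close>. The case assumption gives
      \<open>n * y = ln M + x \<le> 8 * x + 16\<close>.\<close>
    proof (rule main[of 1 "y / 11" 1])
      fix f :: "'a \<Rightarrow> real" and Q
      assume f: "f \<in> bounded_densities L" and Q: "\<And>k::nat. Q k \<in> sets borel"
        and "\<And>k. k < 1 \<Longrightarrow> measure (density lborel (\<lambda>y. ennreal (f y))) (Q k) = y / 11 / real 1"
      then have "measure (iid_law n f) {X \<in> space (iid_law n f). 1 \<le> card (unobserved 1 n Q X)}
        = (1 - y / 11) ^ n"
        by (intro unobserved_single[OF f Q]) auto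
      then show "exp (- x) / 12 \<le> measure (iid_law n f)
          {X \<in> space (iid_law n f). 1 \<le> card (unobserved 1 n Q X)}"
        using one_minus_power_ge[of y n x] y ny True by simp
    qed (use y L M in auto)
  next
    case False
    \<comment> \<open>\<open>K\<close> is the integer part of the binary logarithm of
      \<open>M\<close>.\<close>
    obtain K where K: "2 ^ K \<le> M" "M < 2 ^ (K + 1)"
      using ex_power_ivl1[of 2 M] M by auto
    have "ln (real M) < ln (2 ^ (K + 1))"
    proof -
      have "real M < 2 ^ (K + 1)" using K(2) by (metis of_nat_less_iff of_nat_numeral of_nat_power)
      then show ?thesis using M by (subst ln_less_cancel_iff) auto
    qed
    also have "\<dots> = (real K + 1) * ln 2" by (subst ln_realpow) auto
    also have "\<dots> \<le> (real K + 1) * 1" using ln_2_less_1 by (intro mult_left_mono) auto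
    finally have K_gt: "ln (real M) < real K + 1" by simp
    with False x have K15: "15 < real K" by simp
    \<comment> \<open>Since \<open>x < (ln M - 16) / 7\<close> and \<open>ln M < K + 1\<close>, the
      sum \<open>ln M + x\<close> is below \<open>8 * (K - 1) / 7\<close>.\<close>
    have ny_le: "real n * y \<le> 2 * real K" using K_gt K15 False unfolding ny by simp
    \<comment> \<open>Half of \<open>K\<close> rounded up: \<open>K \<le> 2 * u\<close> serves the
      separation, \<open>2 * u \<le> K + 1\<close> serves \<open>unobserved_half\<close>.\<close>
    define u where "u = (K + 1) div 2"
    have u: "K \<le> 2 * u" "2 * u \<le> K + 1" by (auto simp: u_def)
    show thesis
    \<comment> \<open>With \<open>s = y / 5\<close> the separation holds as
      \<open>s / 2 = y / 10 > y / 12\<close>, and the failure probability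
      \<open>2 * n * s / K\<close> is at most \<open>4 / 5\<close>, leaving
      \<open>1 / 5 \<ge> 1 / 12\<close>.\<close>
    proof (rule main[of K "y / 5" u])
      have "L * y / 12 < L * y / 10" using L y by simp
      also have "\<dots> = y / 5 * L * (real K / 2) / K" using K15 by simp
      also have "\<dots> \<le> y / 5 * L * real u / K"
        using u(1) L y K15 by (intro divide_right_mono mult_left_mono) auto
      finally show "L * y / 12 < y / 5 * L * real u / K" .
      fix f :: "'a \<Rightarrow> real" and Q
      assume f: "f \<in> bounded_densities L" and Q: "\<And>k::nat. Q k \<in> sets borel"
        and "\<And>k. k < K \<Longrightarrow> measure (density lborel (\<lambda>y. ennreal (f y))) (Q k) = y / 5 / K"
      then have "1 - 2 * real n * (y / 5 / K) \<le> measure (iid_law n f)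
          {X \<in> space (iid_law n f). u \<le> card (unobserved K n Q X)}"
        using u(2) y by (intro unobserved_half[OF f Q]) auto
      moreover have "2 * real n * (y / 5 / K) \<le> 4 / 5"
        using ny_le K15 by (simp add: field_simps)
      moreover have "exp (- x) \<le> 1" using x by simp
      ultimately show "exp (- x) / 12 \<le> measure (iid_law n f)
          {X \<in> space (iid_law n f). u \<le> card (unobserved K n Q X)}" by linarith
    qed (use K K15 y in auto)
  qed
qed

section \<open>The dictionary and the minimax bound\<close>

theorem theorem3p2:
  fixes M n :: nat and x L :: real
  assumes "2 \<le> M" and "1 \<le> n" and "0 \<le> x"
    and "(ln (real M) + x) / real n < 3"
    and "0 < L"
  shows "\<exists>g :: nat \<Rightarrow> real ^ 'd::finite \<Rightarrow> real.
    (\<forall>j\<in>{1..M}. g j \<in> L2 \<and> Linf_norm (g j) \<le> ereal L) \<and>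
    (INF T\<in>estimators n. SUP f\<in>bounded_densities L.
       emeasure (iid_law n f)
         {X \<in> space (iid_law n f).
            (L2_norm (\<lambda>y. T X y - f y))\<^sup>2
              - (MIN j\<in>{1..M}. (L2_norm (\<lambda>y. g j y - f y))\<^sup>2)
            > L / 24 * ((ln (real M) + x) / real n)})
      \<ge> ennreal (1 / 24 * exp (- x))"
proof -
  obtain K and f :: "nat set \<Rightarrow> real ^ 'd \<Rightarrow> real"
    where K: "2 ^ K \<le> M" and dens: "\<And>\<omega>. f \<omega> \<in> bounded_densities L"
      and hard: "\<And>T. T \<in> estimators n \<Longrightarrow> \<exists>\<omega>\<subseteq>{..<K}. 1 / 24 * exp (- x) \<le>
        measure (iid_law n (f \<omega>)) {X \<in> space (iid_law n (f \<omega>)).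
          L / 24 * ((ln (real M) + x) / real n) < (L2_norm (\<lambda>y. T X y - f \<omega> y))\<^sup>2}"
    by (rule hard_hypercube[OF assms], rule that, assumption+)
  obtain h :: "nat set \<Rightarrow> nat" where h: "inj_on h (Pow {..<K})" "h ` Pow {..<K} \<subseteq> {1..M}"
    using card_le_inj[of "Pow {..<K}" "{1..M}"] K by (auto simp: card_Pow)
  \<comment> \<open>Indices outside the range of \<open>h\<close> receive \<open>f\<close> at an
    arbitrary argument, again a bounded density because \<open>dens\<close> holds for every
    \<omega>.\<close>
  define g where "g j = f (inv_into (Pow {..<K}) h j)" for j
  have g_h: "g (h \<omega>) = f \<omega>" if "\<omega> \<subseteq> {..<K}" for \<omega>
    using h(1) that by (simp add: g_def inv_into_f_f)
  have Linf: "Linf_norm (g j) \<le> ereal L" and L2: "g j \<in> L2" for j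
    using dens[of "inv_into (Pow {..<K}) h j"] bounded_densities_subset_L2
    by (auto simp: g_def bounded_densities_def)
  \<comment> \<open>Each hard density is in the dictionary, at index \<open>h \<omega>\<close>, so
    for it the excess risk is the plain squared error.\<close>
  have min0: "(MIN j\<in>{1..M}. (L2_norm (\<lambda>y. g j y - f \<omega> y))\<^sup>2) = 0" if \<omega>: "\<omega> \<subseteq> {..<K}" for \<omega>
  proof (rule Min_eqI)
    have zero: "(L2_norm (\<lambda>y. g (h \<omega>) y - f \<omega> y))\<^sup>2 = 0"
      using g_h[OF \<omega>] by (simp add: L2_norm_def)
    have "h \<omega> \<in> {1..M}" using h(2) \<omega> by blast
    then show "0 \<in> (\<lambda>j. (L2_norm (\<lambda>y. g j y - f \<omega> y))\<^sup>2) ` {1..M}"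
      by (rule image_eqI[where x = "h \<omega>", rotated]) (rule zero[symmetric])
  qed auto
  show ?thesis
  proof (intro exI[of _ g] conjI ballI L2 Linf INF_greatest)
    fix T :: "(nat \<Rightarrow> real ^ 'd) \<Rightarrow> real ^ 'd \<Rightarrow> real" assume "T \<in> estimators n"
    from hard[OF this] obtain \<omega> where \<omega>: "\<omega> \<subseteq> {..<K}"
      and le: "1 / 24 * exp (- x) \<le> measure (iid_law n (f \<omega>)) {X \<in> space (iid_law n (f \<omega>)).
          L / 24 * ((ln (real M) + x) / real n) < (L2_norm (\<lambda>y. T X y - f \<omega> y))\<^sup>2}"
      by blast
    interpret prob_space "iid_law n (f \<omega>)" by (rule iid_law_prob_space[OF dens])
    from le have "ennreal (1 / 24 * exp (- x)) \<le> emeasure (iid_law n (f \<omega>)) {X \<in> space (iid_law n (f \<omega>)).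
        (L2_norm (\<lambda>y. T X y - f \<omega> y))\<^sup>2 - (MIN j\<in>{1..M}. (L2_norm (\<lambda>y. g j y - f \<omega> y))\<^sup>2)
          > L / 24 * ((ln (real M) + x) / real n)}"
      unfolding min0[OF \<omega>] emeasure_eq_measure diff_zero by (rule ennreal_leI)
    then show "ennreal (1 / 24 * exp (- x)) \<le> (SUP f\<in>bounded_densities L.
        emeasure (iid_law n f) {X \<in> space (iid_law n f).
          (L2_norm (\<lambda>y. T X y - f y))\<^sup>2 - (MIN j\<in>{1..M}. (L2_norm (\<lambda>y. g j y - f y))\<^sup>2)
            > L / 24 * ((ln (real M) + x) / real n)})"
      by (rule SUP_upper2[OF dens])
  qed
qed

end
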